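(* Let $n\ge 3$ be odd. Among all simple connected graphs of order $n$ with independence number $\lceil n/2\rceil-1$, the unique graph with minimum spectral radius is the cycle $C_n$.
   Context: The spectral radius of a graph is the largest eigenvalue of its adjacency matrix. The independence number is the maximum size of a set of pairwise non-adjacent vertices. $C_n$ is the cycle on $n$ vertices. *)

theory Defs
  imports
    "Graph_Theory.Pair_Digraph"
    "Graph_Theory.Digraph_Isomorphism"
    "Jordan_Normal_Form.Spectral_Radius"
begin

text \<open>
  Finite simple undirected graphs are the locale \<open>graph\<close> of the Graph_Theory library: finite
  symmetric digraphs without loops and without parallel arcs, so that an undirected edge is a pair
  of opposite arcs and \<open>u \<rightarrow>\<^bsub>G\<^esub> v\<close> is adjacency. For such graphs \<open>digraph_iso\<close> is
  graph isomorphism.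
\<close>

definition independent_vertices :: "('a, 'b) pre_digraph \<Rightarrow> 'a set \<Rightarrow> bool" where
  "independent_vertices G S \<longleftrightarrow> S \<subseteq> verts G \<and> pairwise (\<lambda>u v. \<not> u \<rightarrow>\<^bsub>G\<^esub> v) S"

definition independence_number :: "('a, 'b) pre_digraph \<Rightarrow> nat" where
  "independence_number G = Max {card S | S. independent_vertices G S}"

definition adjacency_matrix :: "('a, 'b) pre_digraph \<Rightarrow> 'a list \<Rightarrow> real mat" where
  "adjacency_matrix G vs =
     mat (length vs) (length vs) (\<lambda>(i, j). if vs ! i \<rightarrow>\<^bsub>G\<^esub> vs ! j then 1 else 0)"

text \<open>
  Rows and columns follow an enumeration of the vertices. Its choice does not matter, see
  \<open>graph_spectral_radius_eq\<close> below.
\<close>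

definition graph_spectral_radius :: "('a, 'b) pre_digraph \<Rightarrow> real" where
  "graph_spectral_radius G =
     Max (spectrum (adjacency_matrix G (SOME vs. distinct vs \<and> set vs = verts G)))"

text \<open>The cycle on \<open>0, \<dots>, n - 1\<close>; meaningful for \<open>n \<ge> 3\<close>.\<close>

definition cycle_graph :: "nat \<Rightarrow> (nat, nat \<times> nat) pre_digraph" where
  "cycle_graph n = with_proj
     \<lparr> pverts = {..<n},
       parcs = {(i, j). i < n \<and> j < n \<and> (j = (i + 1) mod n \<or> i = (j + 1) mod n)} \<rparr>"

definition admissible_graph :: "nat \<Rightarrow> ('a, 'b) pre_digraph \<Rightarrow> bool" where
  "admissible_graph n G \<longleftrightarrow>
     graph G \<and> Digraph_Component.connected G \<and> card (verts G) = n \<and>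
     int (independence_number G) = \<lceil>real n / 2\<rceil> - 1"

lemma spectrum_adjacency_matrix_iff:
  assumes "distinct vs"
  shows "k \<in> spectrum (adjacency_matrix G vs) \<longleftrightarrow>
    (\<exists>x. (\<exists>u\<in>set vs. x u \<noteq> 0) \<and>
         (\<forall>u\<in>set vs. (\<Sum>w\<in>set vs. (if u \<rightarrow>\<^bsub>G\<^esub> w then 1 else 0) * x w) = k * x u))"
    (is "?L \<longleftrightarrow> ?R")
proof -
  let ?n = "length vs" and ?A = "adjacency_matrix G vs"
  have dim: "dim_row ?A = ?n" "dim_col ?A = ?n"
    by (simp_all add: adjacency_matrix_def)
  have inj: "inj_on ((!) vs) {0..<?n}" and img: "(!) vs ` {0..<?n} = set vs"
    using assms by (auto simp: inj_on_def nth_eq_iff_index_eq set_conv_nth)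
  have mv: "(?A *\<^sub>v v) $ i = (\<Sum>w\<in>set vs. (if vs ! i \<rightarrow>\<^bsub>G\<^esub> w then 1 else 0) * x w)"
    if i: "i < ?n" and v: "v \<in> carrier_vec ?n" and x: "\<And>j. j < ?n \<Longrightarrow> x (vs ! j) = v $ j"
    for i v and x :: "'a \<Rightarrow> real"
  proof -
    have "(?A *\<^sub>v v) $ i = (\<Sum>j = 0..<?n. (if vs ! i \<rightarrow>\<^bsub>G\<^esub> vs ! j then 1 else 0) * x (vs ! j))"
      using i v x by (auto simp: adjacency_matrix_def scalar_prod_def intro!: sum.cong)
    also have "\<dots> = (\<Sum>w\<in>(!) vs ` {0..<?n}. (if vs ! i \<rightarrow>\<^bsub>G\<^esub> w then 1 else 0) * x w)"
      by (simp add: sum.reindex[OF inj])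
    finally show ?thesis by (simp only: img)
  qed
  show ?thesis
  proof
    assume ?L
    then obtain v where v: "v \<in> carrier_vec ?n" "v \<noteq> 0\<^sub>v ?n" "?A *\<^sub>v v = k \<cdot>\<^sub>v v"
      by (auto simp: spectrum_def eigenvalue_def eigenvector_def dim)
    define x where "x = (\<lambda>u. v $ (the_inv_into {0..<?n} ((!) vs) u))"
    have x: "x (vs ! j) = v $ j" if "j < ?n" for j
      using the_inv_into_f_f[OF inj, of j] that by (simp add: x_def)
    have "\<exists>i<?n. v $ i \<noteq> 0"
    proof (rule ccontr)
      assume "\<not> ?thesis"
      then have "v = 0\<^sub>v ?n" using v(1) by (intro eq_vecI) auto
      with v(2) show False by simp
    qed
    then have "\<exists>u\<in>set vs. x u \<noteq> 0" using x nth_mem by metis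
    moreover have "(\<Sum>w\<in>set vs. (if u \<rightarrow>\<^bsub>G\<^esub> w then 1 else 0) * x w) = k * x u"
      if "u \<in> set vs" for u
    proof -
      obtain i where i: "i < ?n" "vs ! i = u" using \<open>u \<in> set vs\<close> by (auto simp: in_set_conv_nth)
      have "(?A *\<^sub>v v) $ i = k * v $ i" using v(1) i(1) by (simp add: v(3))
      with mv[OF i(1) v(1) x] x[OF i(1)] i(2) show ?thesis by simp
    qed
    ultimately show ?R by blast
  next
    assume ?R
    then obtain x where nz: "\<exists>u\<in>set vs. x u \<noteq> 0"
      and ev: "\<And>u. u \<in> set vs \<Longrightarrow>
        (\<Sum>w\<in>set vs. (if u \<rightarrow>\<^bsub>G\<^esub> w then 1 else 0) * x w) = k * x u"
      by blast
    define v where "v = vec ?n (\<lambda>i. x (vs ! i))"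
    have v: "v \<in> carrier_vec ?n" and x: "\<And>j. j < ?n \<Longrightarrow> x (vs ! j) = v $ j"
      by (simp_all add: v_def)
    have "v \<noteq> 0\<^sub>v ?n"
    proof
      assume "v = 0\<^sub>v ?n"
      then have "x (vs ! j) = 0" if "j < ?n" for j using x that by simp
      with nz show False by (metis in_set_conv_nth)
    qed
    moreover have "?A *\<^sub>v v = k \<cdot>\<^sub>v v"
    proof (rule eq_vecI)
      fix i assume "i < dim_vec (k \<cdot>\<^sub>v v)"
      then have i: "i < ?n" using v by simp
      then show "(?A *\<^sub>v v) $ i = (k \<cdot>\<^sub>v v) $ i"
        using mv[OF i v x] ev[of "vs ! i"] x[OF i] v by simp
    qed (use v dim in simp)
    ultimately show ?L
      using v by (auto simp: spectrum_def eigenvalue_def eigenvector_def dim)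
  qed
qed

lemma graph_spectral_radius_eq:
  assumes "distinct vs" "set vs = verts G"
  shows "graph_spectral_radius G = Max (spectrum (adjacency_matrix G vs))"
proof -
  define ws where "ws = (SOME vs. distinct vs \<and> set vs = verts G)"
  have ws: "distinct ws \<and> set ws = verts G"
    unfolding ws_def by (rule someI[of _ vs]) (use assms in simp)
  have "spectrum (adjacency_matrix G ws) = spectrum (adjacency_matrix G vs)"
    using ws assms by - (rule Set.set_eqI, simp add: spectrum_adjacency_matrix_iff)
  then show ?thesis by (simp add: graph_spectral_radius_def ws_def)
qed

end

theory Submission
  imports Defs "HOL-Analysis.Function_Topology"
begin

text \<open>
  A connected graph with fewer edges than vertices is 2-colourable, so it has an independent set
  containing at least half of its vertices. For odd \<open>n\<close> the prescribed independence number is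
  smaller, hence there are at least \<open>n\<close> edges, and the Rayleigh quotient of the all-ones vector,
  which is the average degree, forces the spectral radius to be at least 2. Equality makes the
  all-ones vector an eigenvector for the eigenvalue 2, so the graph is 2-regular and, being
  connected, a cycle.
\<close>

section \<open>The largest eigenvalue as a maximal Rayleigh quotient\<close>

text \<open>First-order condition at a maximiser: perturbing \<open>x\<close> by \<open>t\<close> in
  the single coordinate \<open>v\<close> turns \<open>le\<close> and \<open>eq\<close> into a
  quadratic inequality in \<open>t\<close> without constant term, whose linear coefficient must
  therefore vanish.\<close>

lemma rayleigh_maximizer_eigenvector:
  fixes a :: "'a \<Rightarrow> 'a \<Rightarrow> real"
  assumes fin: "finite V"
    and sym: "\<And>u w. u \<in> V \<Longrightarrow> w \<in> V \<Longrightarrow> a u w = a w u"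
    and le: "\<And>y. (\<Sum>u\<in>V. \<Sum>w\<in>V. a u w * y u * y w) \<le> k * (\<Sum>u\<in>V. (y u)\<^sup>2)"
    and eq: "(\<Sum>u\<in>V. \<Sum>w\<in>V. a u w * x u * x w) = k * (\<Sum>u\<in>V. (x u)\<^sup>2)"
    and v: "v \<in> V"
  shows "(\<Sum>w\<in>V. a v w * x w) = k * x v"
proof -
  define b where "b = (\<Sum>w\<in>V. a v w * x w) - k * x v"
  have quad: "2 * t * b \<le> t\<^sup>2 * (k - a v v)" for t
  proof -
    define e where "e = (\<lambda>u. if u = v then 1 else 0 :: real)"
    have e1: "(\<Sum>u\<in>V. f u * e u) = f v" for f
      using fin v by (simp add: e_def if_distrib cong: if_cong)
    have e2: "(\<Sum>u\<in>V. e u * f u) = f v" for f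
      using e1[of f] by (simp add: mult.commute)
    have row: "(\<Sum>w\<in>V. a w v * x w) = (\<Sum>w\<in>V. a v w * x w)"
      using sym v by (intro sum.cong) auto
    have "(\<Sum>u\<in>V. \<Sum>w\<in>V. a u w * (x u + t * e u) * (x w + t * e w))
        = (\<Sum>u\<in>V. \<Sum>w\<in>V. a u w * x u * x w)
          + t * (\<Sum>u\<in>V. \<Sum>w\<in>V. (a u w * x u) * e w)
          + t * (\<Sum>u\<in>V. e u * (\<Sum>w\<in>V. a u w * x w))
          + t\<^sup>2 * (\<Sum>u\<in>V. e u * (\<Sum>w\<in>V. a u w * e w))"
      by (simp add: algebra_simps sum.distrib sum_distrib_left power2_eq_square)
    also have "\<dots> = k * (\<Sum>u\<in>V. (x u)\<^sup>2) + 2 * t * (\<Sum>w\<in>V. a v w * x w) + t\<^sup>2 * a v v"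
      by (simp add: e1 e2 eq row)
    finally have lhs: "(\<Sum>u\<in>V. \<Sum>w\<in>V. a u w * (x u + t * e u) * (x w + t * e w)) = \<dots>" .
    have "(\<Sum>u\<in>V. (x u + t * e u)\<^sup>2)
        = (\<Sum>u\<in>V. (x u)\<^sup>2) + 2 * t * (\<Sum>u\<in>V. x u * e u) + t\<^sup>2 * (\<Sum>u\<in>V. e u * e u)"
      by (simp add: algebra_simps sum.distrib sum_distrib_left power2_eq_square)
    also have "\<dots> = (\<Sum>u\<in>V. (x u)\<^sup>2) + 2 * t * x v + t\<^sup>2"
      by (simp add: e1) (simp add: e_def)
    finally have rhs: "(\<Sum>u\<in>V. (x u + t * e u)\<^sup>2) = \<dots>" .
    show ?thesis
      using le[of "\<lambda>u. x u + t * e u"] unfolding lhs rhs b_def by (simp add: algebra_simps)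
  qed
  have "b = 0"
  proof (rule ccontr)
    assume "b \<noteq> 0"
    \<comment> \<open>\<open>c\<close> is positive and exceeds \<open>k - a v v\<close>, whatever
      the sign of the latter, so \<open>t = b / c\<close> makes the linear term win over the
      quadratic one.\<close>
    define c where "c = \<bar>k - a v v\<bar> + 1"
    have c: "c > 0" "k - a v v < c" by (auto simp: c_def)
    have "2 * b\<^sup>2 / c \<le> b\<^sup>2 * (k - a v v) / c\<^sup>2"
      using quad[of "b / c"] by (simp add: power2_eq_square field_simps)
    also have "\<dots> \<le> b\<^sup>2 * c / c\<^sup>2"
      using c by (intro divide_right_mono mult_left_mono) auto
    also have "\<dots> = b\<^sup>2 / c" using c by (simp add: power2_eq_square)
    finally have "b\<^sup>2 / c \<le> 0" by simp
    moreover have "b\<^sup>2 / c > 0" using c \<open>b \<noteq> 0\<close> by simp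
    ultimately show False by simp
  qed
  then show ?thesis by (simp add: b_def)
qed

text \<open>Tychonoff's theorem. The type \<open>'a\<close> may be infinite, so compactness in the
  product topology needs every coordinate bounded, not only those in a finite vertex set.\<close>

lemma compact_cube: "compact {x :: 'a \<Rightarrow> real. \<forall>i. x i \<in> {-1..1}}"
proof -
  have "compactin (product_topology (\<lambda>_::'a. euclidean :: real topology) UNIV) (\<Pi>\<^sub>E i\<in>UNIV. {-1..1})"
    by (simp add: compactin_PiE)
  moreover have "(\<Pi>\<^sub>E i\<in>UNIV. {-1..1}) = {x :: 'a \<Rightarrow> real. \<forall>i. x i \<in> {-1..1}}"
    by (auto simp: PiE_def Pi_def)
  ultimately show ?thesis
    by (simp add: euclidean_product_topology)
qed

text \<open>The quadratic form attains its maximum on a compact piece of the unit sphere;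
  homogeneity extends the bound to all vectors, and the first-order condition makes the maximiser an
  eigenvector.\<close>

lemma symmetric_max_eigenvalue:
  fixes a :: "'a \<Rightarrow> 'a \<Rightarrow> real"
  assumes fin: "finite V" and ne: "V \<noteq> {}"
    and sym: "\<And>u w. u \<in> V \<Longrightarrow> w \<in> V \<Longrightarrow> a u w = a w u"
  obtains x k where "\<exists>u\<in>V. x u \<noteq> 0" "\<forall>u\<in>V. (\<Sum>w\<in>V. a u w * x w) = k * x u"
    "\<forall>y. (\<Sum>u\<in>V. \<Sum>w\<in>V. a u w * y u * y w) \<le> k * (\<Sum>u\<in>V. (y u)\<^sup>2)"
proof -
  define q where "q = (\<lambda>y. \<Sum>u\<in>V. \<Sum>w\<in>V. a u w * y u * y w)"
  define N where "N = (\<lambda>y :: 'a \<Rightarrow> real. \<Sum>u\<in>V. (y u)\<^sup>2)"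
  have cont: "continuous_on S q" "continuous_on S N" for S
    unfolding q_def N_def
    by (intro continuous_intros continuous_on_subset[OF continuous_on_product_coordinates]; simp)+
  \<comment> \<open>Coordinates outside \<open>V\<close> enter neither \<open>q\<close> nor
    \<open>N\<close>; the cube bounds them and so gives compactness.\<close>
  define S where "S = {x :: 'a \<Rightarrow> real. \<forall>i. x i \<in> {-1..1}} \<inter> {x. N x = 1}"
  have "closed {x. N x = 1}"
    by (intro closed_Collect_eq cont continuous_intros)
  then have "compact S" unfolding S_def by (intro compact_Int_closed compact_cube)
  obtain v where v: "v \<in> V" using ne by blast
  have "(\<lambda>u. if u = v then 1 else 0) \<in> S"
    using fin v by (auto simp: S_def N_def if_distrib[of "\<lambda>x. x ^ 2"] cong: if_cong)
  then have "S \<noteq> {}" by blast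
  from continuous_attains_sup[OF \<open>compact S\<close> this cont(1)]
  obtain x where x: "x \<in> S" and max: "\<And>y. y \<in> S \<Longrightarrow> q y \<le> q x" by blast
  have N0: "y u = 0" if "N y = 0" "u \<in> V" for y u
    using that fin by (simp add: N_def sum_nonneg_eq_0_iff)
  have le: "q y \<le> q x * N y" for y
  proof (cases "N y = 0")
    case True
    then have "q y = 0" using N0 by (auto simp: q_def intro!: sum.neutral)
    with True show ?thesis by simp
  next
    case False
    then have pos: "N y > 0" by (simp add: N_def sum_nonneg less_le)
    define s where "s = sqrt (N y)"
    have s: "s > 0" "s\<^sup>2 = N y" using pos by (auto simp: s_def)
    \<comment> \<open>Normalising and putting 0 outside \<open>V\<close> places the vector in the
      cube without changing the Rayleigh quotient.\<close>
    define z where "z = (\<lambda>u. if u \<in> V then y u / s else 0)"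
    have "N z = (\<Sum>u\<in>V. (y u)\<^sup>2 / s\<^sup>2)"
      unfolding N_def by (intro sum.cong) (auto simp: z_def power_divide)
    also have "\<dots> = N y / s\<^sup>2" by (simp add: N_def sum_divide_distrib)
    also have "\<dots> = 1" using s pos by simp
    finally have Nz: "N z = 1" .
    have "(z u)\<^sup>2 \<le> 1" for u
    proof (cases "u \<in> V")
      case True
      then have "(z u)\<^sup>2 \<le> N z" unfolding N_def using fin by (intro member_le_sum) auto
      with Nz show ?thesis by simp
    qed (simp add: z_def)
    then have "z \<in> S" using Nz by (auto simp: S_def abs_square_le_1 abs_le_iff)
    from max[OF this] have "q z \<le> q x" .
    moreover have "q z = q y / s\<^sup>2"
      unfolding q_def sum_divide_distrib
      by (intro sum.cong) (auto simp: z_def power2_eq_square)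
    ultimately show ?thesis using s pos by (simp add: field_simps)
  qed
  have Nx: "N x = 1" using x by (simp add: S_def)
  have "\<exists>u\<in>V. x u \<noteq> 0"
  proof (rule ccontr)
    assume "\<not> ?thesis"
    then have "N x = 0" by (simp add: N_def)
    with Nx show False by simp
  qed
  moreover have "(\<Sum>w\<in>V. a u w * x w) = q x * x u" if "u \<in> V" for u
    by (rule rayleigh_maximizer_eigenvector[OF fin sym _ _ that])
      (use le Nx in \<open>auto simp: q_def N_def\<close>)
  ultimately show thesis using le that unfolding q_def N_def by blast
qed

section \<open>Spectral radius, average degree and regular graphs\<close>

lemma graph_spectrum_iff:
  assumes "distinct vs" "set vs = verts G" "wf_digraph G" "finite (verts G)"
  shows "k \<in> spectrum (adjacency_matrix G vs) \<longleftrightarrow>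
    (\<exists>x. (\<exists>u\<in>verts G. x u \<noteq> 0) \<and>
         (\<forall>u\<in>verts G. (\<Sum>w\<in>arcs_ends G `` {u}. x w) = k * x u))"
proof -
  interpret wf_digraph G by fact
  have "(\<Sum>w\<in>verts G. (if u \<rightarrow>\<^bsub>G\<^esub> w then 1 else 0) * x w) = (\<Sum>w\<in>arcs_ends G `` {u}. x w)"
    for u and x :: "'a \<Rightarrow> real"
    by (rule sum.mono_neutral_cong_right) (use assms(4) adj_in_verts in auto)
  then show ?thesis
    unfolding spectrum_adjacency_matrix_iff[OF assms(1)] assms(2) by simp
qed

lemma finite_spectrum_adjacency_matrix: "finite (spectrum (adjacency_matrix G vs))"
  by (rule card_finite_spectrum(1)[of _ "length vs"]) (simp add: adjacency_matrix_def)

lemma (in wf_digraph) card_arcs_ends_eq_sum: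
  assumes "finite (verts G)"
  shows "card (arcs_ends G) = (\<Sum>u\<in>verts G. card (arcs_ends G `` {u}))"
proof -
  have fin: "finite (arcs_ends G `` {u})" for u
    by (rule finite_subset[OF _ assms]) (auto dest: adj_in_verts)
  have "arcs_ends G = Sigma (verts G) (\<lambda>u. arcs_ends G `` {u})"
    by (auto dest: adj_in_verts)
  then have "card (arcs_ends G) = card (Sigma (verts G) (\<lambda>u. arcs_ends G `` {u}))" by simp
  also have "\<dots> = (\<Sum>u\<in>verts G. card (arcs_ends G `` {u}))"
    using assms fin by (intro card_SigmaI) auto
  finally show ?thesis .
qed

text \<open>The all-ones vector has the average degree as its Rayleigh quotient. In the equality
  case it is a maximiser, hence an eigenvector, and its eigenvalue equation at \<open>u\<close>
  reads off the degree of \<open>u\<close>.\<close>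

lemma (in graph) card_arcs_ends_le_spectral_radius:
  assumes ne: "verts G \<noteq> {}"
  shows "real (card (arcs_ends G)) \<le> graph_spectral_radius G * real (card (verts G))"
    and "real (card (arcs_ends G)) = graph_spectral_radius G * real (card (verts G)) \<Longrightarrow>
      u \<in> verts G \<Longrightarrow> real (card (arcs_ends G `` {u})) = graph_spectral_radius G"
proof -
  let ?V = "verts G" and ?\<rho> = "graph_spectral_radius G"
  define a where "a = (\<lambda>u w. if u \<rightarrow>\<^bsub>G\<^esub> w then 1 else 0 :: real)"
  have row: "(\<Sum>w\<in>?V. a u w * y w) = (\<Sum>w\<in>arcs_ends G `` {u}. y w)" for u y
    unfolding a_def by (rule sum.mono_neutral_cong_right) (auto dest: adj_in_verts)
  have sym: "a u w = a w u" for u w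
    using graph_symmetric by (auto simp: a_def)
  obtain x k where x: "\<exists>u\<in>?V. x u \<noteq> 0" "\<forall>u\<in>?V. (\<Sum>w\<in>?V. a u w * x w) = k * x u"
    and le: "\<forall>y. (\<Sum>u\<in>?V. \<Sum>w\<in>?V. a u w * y u * y w) \<le> k * (\<Sum>u\<in>?V. (y u)\<^sup>2)"
    by (rule symmetric_max_eigenvalue[OF finite_verts ne, of a, OF sym])
  obtain vs where vs: "distinct vs" "set vs = ?V"
    using finite_distinct_list[OF finite_verts] by blast
  have "k \<in> spectrum (adjacency_matrix G vs)"
    unfolding graph_spectrum_iff[OF vs wf_digraph finite_verts]
    by (rule exI[of _ x]) (use x row in auto)
  then have k: "k \<le> ?\<rho>"
    unfolding graph_spectral_radius_eq[OF vs] by (simp add: finite_spectrum_adjacency_matrix)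
  have ones: "(\<Sum>u\<in>?V. \<Sum>w\<in>?V. a u w * 1 * 1) = real (card (arcs_ends G))"
    using row[of _ "\<lambda>_. 1"] by (simp add: card_arcs_ends_eq_sum)
  have card_le: "real (card (arcs_ends G)) \<le> k * real (card ?V)"
    using le[rule_format, of "\<lambda>_. 1"] unfolding ones by simp
  also have "\<dots> \<le> ?\<rho> * real (card ?V)" using k by (intro mult_right_mono) auto
  finally show "real (card (arcs_ends G)) \<le> ?\<rho> * real (card ?V)" .
  assume eq: "real (card (arcs_ends G)) = ?\<rho> * real (card ?V)" and u: "u \<in> ?V"
  \<comment> \<open>Equality of the outer terms in
    \<open>card (arcs_ends G) \<le> k * card V \<le> \<rho> * card V\<close> collapses the chain,
    and dividing by the positive \<open>card V\<close> identifies \<open>k\<close> with the spectral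
    radius.\<close>
  have "card ?V > 0" using ne by (simp add: card_gt_0_iff)
  with card_le k eq have k_eq: "k = ?\<rho>" by simp
  have "(\<Sum>w\<in>?V. a u w * 1) = k * 1"
    by (rule rayleigh_maximizer_eigenvector[where a=a, OF finite_verts sym le[rule_format] _ u])
      (use ones eq k_eq in simp)
  then show "real (card (arcs_ends G `` {u})) = ?\<rho>"
    using row[of _ "\<lambda>_. 1"] k_eq by simp
qed

text \<open>The all-ones vector realises \<open>d\<close>. No eigenvalue is larger: at a vertex
  where an eigenvector has maximal modulus, the sum over \<open>d\<close> neighbours is at most
  \<open>d\<close> times that modulus.\<close>

lemma (in fin_digraph) spectral_radius_regular:
  assumes ne: "verts G \<noteq> {}" and deg: "\<And>u. u \<in> verts G \<Longrightarrow> card (arcs_ends G `` {u}) = d"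
  shows "graph_spectral_radius G = real d"
proof -
  obtain vs where vs: "distinct vs" "set vs = verts G"
    using finite_distinct_list[OF finite_verts] by blast
  note iff = graph_spectrum_iff[OF vs wf_digraph finite_verts]
  have "real d \<in> spectrum (adjacency_matrix G vs)"
    unfolding iff by (rule exI[of _ "\<lambda>_. 1"]) (use ne deg in auto)
  moreover have "k \<le> real d" if "k \<in> spectrum (adjacency_matrix G vs)" for k
  proof -
    from that obtain x where nz: "\<exists>u\<in>verts G. x u \<noteq> 0"
      and ev: "\<And>u. u \<in> verts G \<Longrightarrow> (\<Sum>w\<in>arcs_ends G `` {u}. x w) = k * x u"
      unfolding iff by blast
    define M where "M = Max ((\<lambda>u. \<bar>x u\<bar>) ` verts G)"
    have "M \<in> (\<lambda>u. \<bar>x u\<bar>) ` verts G" unfolding M_def using ne by (intro Max_in) auto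
    then obtain u where u: "u \<in> verts G" "\<bar>x u\<bar> = M" by auto
    have le: "\<bar>x w\<bar> \<le> M" if "w \<in> verts G" for w
      unfolding M_def using that by (intro Max_ge) auto
    have "M > 0" using nz le by force
    have "k * M \<le> \<bar>k * x u\<bar>" using u(2) by (simp add: abs_mult mult_right_mono)
    also have "\<dots> \<le> (\<Sum>w\<in>arcs_ends G `` {u}. \<bar>x w\<bar>)"
      unfolding ev[OF u(1), symmetric] by (rule sum_abs)
    also have "\<dots> \<le> (\<Sum>w\<in>arcs_ends G `` {u}. M)"
      by (intro sum_mono le) (auto dest: adj_in_verts)
    also have "\<dots> = real d * M" using deg[OF u(1)] by simp
    finally show ?thesis using \<open>M > 0\<close> by simp
  qed
  ultimately show ?thesis
    unfolding graph_spectral_radius_eq[OF vs]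
    by (intro Max_eqI finite_spectrum_adjacency_matrix) auto
qed

section \<open>Connectedness and independent sets\<close>

text \<open>\<open>connected\<close> means strong connectedness of the symmetric closure, which has
  the same reachability as \<open>G\<close> because the arcs are already symmetric.\<close>

lemma (in sym_digraph) connected_iff_rtrancl:
  "Digraph_Component.connected G \<longleftrightarrow>
    verts G \<noteq> {} \<and> (\<forall>u\<in>verts G. \<forall>v\<in>verts G. (u, v) \<in> (arcs_ends G)\<^sup>*)"
proof -
  have "verts (with_proj (mk_symmetric G)) = verts G" by (simp add: mk_symmetric_def)
  then show ?thesis
    by (auto simp: Digraph_Component.connected_def strongly_connected_def
        reachable_mk_symmetric_eq[OF sym_arcs] reachable_conv)
qed

lemma independence_number_ge:
  assumes "finite (verts G)" "independent_vertices G S"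
  shows "card S \<le> independence_number G"
  unfolding independence_number_def
proof (rule Max_ge)
  have "{card S |S. independent_vertices G S} \<subseteq> card ` Pow (verts G)"
    by (auto simp: independent_vertices_def)
  then show "finite {card S |S. independent_vertices G S}"
    by (rule finite_subset) (use assms(1) in simp)
  show "card S \<in> {card S |S. independent_vertices G S}" using assms(2) by blast
qed

text \<open>The arcs of a breadth-first spanning tree join consecutive distance levels. If there are too
  few arcs to allow any further edge, no edge stays within a parity class of levels.\<close>

lemma few_arcs_imp_large_independent_set:
  assumes fin: "finite V" and sub: "E \<subseteq> V \<times> V" and sym: "sym E" and irrefl: "irrefl E"
    and conn: "\<And>u v. u \<in> V \<Longrightarrow> v \<in> V \<Longrightarrow> (u, v) \<in> E\<^sup>*"
    and few: "card E < 2 * card V"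
  obtains S where "S \<subseteq> V" "E \<inter> S \<times> S = {}" "card V \<le> 2 * card S"
proof -
  have "V \<noteq> {}" using few by auto
  then obtain r where r: "r \<in> V" by blast
  \<comment> \<open>The distance from the root \<open>r\<close>; by connectedness the
    \<open>LEAST\<close> is attained on \<open>V\<close>.\<close>
  define d where "d = (\<lambda>v. LEAST k. (r, v) \<in> E ^^ k)"
  have d_walk: "(r, v) \<in> E ^^ d v" if "v \<in> V" for v
  proof -
    from conn[OF r that] obtain k where "(r, v) \<in> E ^^ k" by (auto simp: rtrancl_power)
    then show ?thesis unfolding d_def by (rule LeastI)
  qed
  have d_le: "d v \<le> k" if "(r, v) \<in> E ^^ k" for v k
    unfolding d_def using that by (rule Least_le)
  have d_step: "d w \<le> Suc (d u)" if "(u, w) \<in> E" for u w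
    by (rule d_le) (use d_walk[of u] that sub in auto)
  have "\<exists>p. (p, v) \<in> E \<and> d v = Suc (d p)" if v: "v \<in> V - {r}" for v
  proof -
    have "d v \<noteq> 0"
    proof
      assume "d v = 0"
      with d_walk[of v] v show False by auto
    qed
    then obtain k where k: "d v = Suc k" using not0_implies_Suc by blast
    with d_walk[of v] v obtain p where p: "(r, p) \<in> E ^^ k" "(p, v) \<in> E" by auto
    from d_le[OF p(1)] d_step[OF p(2)] k have "d v = Suc (d p)" by simp
    with p(2) show ?thesis by blast
  qed
  \<comment> \<open>\<open>p v\<close> is the parent of \<open>v\<close> in a breadth-first tree,
    one level closer to the root.\<close>
  then obtain p where p: "\<And>v. v \<in> V - {r} \<Longrightarrow> (p v, v) \<in> E \<and> d v = Suc (d (p v))"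
    by metis
  \<comment> \<open>\<open>A\<close> and \<open>B\<close> are the two orientations of the tree
    edges, together \<open>2 * (card V - 1)\<close> arcs.\<close>
  define A where "A = (\<lambda>v. (p v, v)) ` (V - {r})"
  define B where "B = (\<lambda>v. (v, p v)) ` (V - {r})"
  have cardA: "card A = card V - 1" unfolding A_def
    using r by (subst card_image) (auto simp: inj_on_def)
  have cardB: "card B = card V - 1" unfolding B_def
    using r by (subst card_image) (auto simp: inj_on_def)
  have finAB: "finite A" "finite B" using fin by (auto simp: A_def B_def)
  have finE: "finite E" using finite_subset[OF sub] fin by simp
  have parity: "even (d u) \<noteq> even (d w)" if uw: "(u, w) \<in> E" for u w
  proof
    assume same: "even (d u) = even (d w)"
    have wu: "(w, u) \<in> E" using sym uw by (rule symD)
    \<comment> \<open>Levels of adjacent vertices differ by at most one, so equal parity forces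
      equal levels.\<close>
    have "d u = d w" using d_step[OF uw] d_step[OF wu] same
      by (metis even_Suc le_Suc_eq le_antisym)
    define C where "C = {(u, w), (w, u)}"
    have "u \<noteq> w" using irrefl uw by (auto simp: irrefl_def)
    then have cardC: "card C = 2" by (auto simp: C_def)
    \<comment> \<open>Arcs of \<open>A\<close> go one level down from the root, arcs of
      \<open>B\<close> one level up, arcs of \<open>C\<close> stay level. So the three sets are
      disjoint and already hold \<open>2 * card V\<close> arcs of \<open>E\<close>, against
      \<open>few\<close>.\<close>
    have levels: "A \<subseteq> {e. d (snd e) = Suc (d (fst e))}" "B \<subseteq> {e. d (fst e) = Suc (d (snd e))}"
      "C \<subseteq> {e. d (fst e) = d (snd e)}"
      unfolding A_def B_def C_def using p \<open>d u = d w\<close> by auto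
    then have "A \<inter> B = {}" by fastforce
    moreover have "(A \<union> B) \<inter> C = {}" using levels by fastforce
    ultimately have "card (A \<union> B \<union> C) = card A + card B + card C"
      using finAB cardC by (simp add: card_Un_disjoint card_ge_0_finite)
    also have "\<dots> = 2 * card V"
      using r fin card_gt_0_iff[of V] unfolding cardA cardB cardC by auto
    finally have "card (A \<union> B \<union> C) = 2 * card V" .
    moreover have "A \<union> B \<union> C \<subseteq> E"
      unfolding A_def B_def C_def using p uw wu sym by (auto dest: symD)
    ultimately show False using card_mono[OF finE, of "A \<union> B \<union> C"] few by simp
  qed
  \<comment> \<open>Both parity classes are independent, and the larger one contains at least half
    of the vertices.\<close>
  define S where "S = (\<lambda>b. {v \<in> V. even (d v) = b})"
  have "card V = card (S True \<union> S False)"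
    by (rule arg_cong[where f=card]) (auto simp: S_def)
  also have "\<dots> \<le> card (S True) + card (S False)" by (rule card_Un_le)
  finally have "card V \<le> 2 * card (S True) \<or> card V \<le> 2 * card (S False)" by linarith
  then obtain b where "card V \<le> 2 * card (S b)" by blast
  moreover have "E \<inter> S b \<times> S b = {}" using parity by (auto simp: S_def)
  moreover have "S b \<subseteq> V" by (auto simp: S_def)
  ultimately show thesis using that by blast
qed

text \<open>\<open>arcs_ends\<close> counts each edge in both directions, so this bounds the number
  of edges below by the number of vertices. Fewer edges would yield an independent set containing at
  least half of the vertices.\<close>

lemma (in graph) card_arcs_ends_ge_of_independence_number:
  assumes conn: "Digraph_Component.connected G"
    and alpha: "2 * independence_number G < card (verts G)"
  shows "2 * card (verts G) \<le> card (arcs_ends G)"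
proof (rule ccontr)
  assume "\<not> ?thesis"
  then have few: "card (arcs_ends G) < 2 * card (verts G)" by simp
  have "arcs_ends G \<subseteq> verts G \<times> verts G" "sym (arcs_ends G)" "irrefl (arcs_ends G)"
    using sym_arcs adj_not_same by (auto simp: symmetric_def irrefl_def dest: adj_in_verts)
  moreover have "(u, v) \<in> (arcs_ends G)\<^sup>*" if "u \<in> verts G" "v \<in> verts G" for u v
    using conn that unfolding connected_iff_rtrancl by blast
  ultimately obtain S where S: "S \<subseteq> verts G" "arcs_ends G \<inter> S \<times> S = {}"
    "card (verts G) \<le> 2 * card S"
    using few_arcs_imp_large_independent_set[OF finite_verts _ _ _ _ few] by blast
  then have "independent_vertices G S"
    by (auto simp: independent_vertices_def pairwise_def)
  from independence_number_ge[OF finite_verts this] S(3) alpha show False by simp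
qed

section \<open>Cycles\<close>

lemma verts_cycle_graph [simp]: "verts (cycle_graph n) = {..<n}"
  by (simp add: cycle_graph_def)

text \<open>Trades \<open>mod\<close> for explicit wrap-around cases that linear arithmetic can
  handle.\<close>

lemma cycle_graph_adj_iff:
  "i \<rightarrow>\<^bsub>cycle_graph n\<^esub> j \<longleftrightarrow>
    i < n \<and> j < n \<and> (j = Suc i \<or> i = Suc j \<or> Suc i = n \<and> j = 0 \<or> i = 0 \<and> Suc j = n)"
  by (auto simp: cycle_graph_def mod_Suc)

lemma graph_cycle_graph:
  assumes "n \<ge> 3"
  shows "graph (cycle_graph n)"
proof -
  have arcs: "arcs (cycle_graph n) = arcs_ends (cycle_graph n)"
    "tail (cycle_graph n) = fst" "head (cycle_graph n) = snd"
    by (simp_all add: cycle_graph_def)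
  have "arcs_ends (cycle_graph n) \<subseteq> {..<n} \<times> {..<n}"
    by (auto simp: cycle_graph_adj_iff)
  then have "finite (arcs_ends (cycle_graph n))" by (rule finite_subset) simp
  then show ?thesis
    using assms
    by unfold_locales
      (auto simp: arcs cycle_graph_adj_iff arc_to_ends_def symmetric_def sym_def)
qed

text \<open>The two ends of the numbering wrap around, hence three cases; \<open>n \<ge> 3\<close>
  keeps the two neighbours distinct.\<close>

lemma card_neighbours_cycle_graph:
  assumes "n \<ge> 3" "i < n"
  shows "card (arcs_ends (cycle_graph n) `` {i}) = 2"
proof -
  consider "i = 0" | "Suc i = n" | "0 < i" "Suc i < n" using assms by linarith
  then show ?thesis
  proof cases
    case 1
    then have "arcs_ends (cycle_graph n) `` {i} = {1, n - 1}"
      using assms by (auto simp: cycle_graph_adj_iff)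
    with assms show ?thesis by simp
  next
    case 2
    then have "arcs_ends (cycle_graph n) `` {i} = {0, n - 2}"
      using assms by (auto simp: cycle_graph_adj_iff)
    with assms show ?thesis by simp
  next
    case 3
    then have "arcs_ends (cycle_graph n) `` {i} = {i - 1, Suc i}"
      using assms by (auto simp: cycle_graph_adj_iff)
    then show ?thesis by simp
  qed
qed

lemma connected_cycle_graph:
  assumes "n \<ge> 3"
  shows "Digraph_Component.connected (cycle_graph n)"
proof -
  interpret graph "cycle_graph n" using assms by (rule graph_cycle_graph)
  have up: "i < n \<Longrightarrow> (0, i) \<in> (arcs_ends (cycle_graph n))\<^sup>*" for i
  proof (induction i)
    case (Suc i)
    then have "i \<rightarrow>\<^bsub>cycle_graph n\<^esub> Suc i" by (simp add: cycle_graph_adj_iff)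
    with Suc show ?case by (auto intro: rtrancl_into_rtrancl)
  qed simp
  have "sym ((arcs_ends (cycle_graph n))\<^sup>*)"
    using sym_arcs by (simp add: symmetric_def sym_rtrancl)
  with up have "(i, j) \<in> (arcs_ends (cycle_graph n))\<^sup>*" if "i < n" "j < n" for i j
    using that by (meson rtrancl_trans symD)
  then show ?thesis using assms by (auto simp: connected_iff_rtrancl lessThan_empty_iff)
qed

text \<open>Every second vertex gives the lower bound. For the upper bound, rotating an independent
  set by one step gives a disjoint set of the same size, so twice its size is at most
  \<open>n\<close>.\<close>

lemma independence_number_cycle_graph:
  assumes "n \<ge> 3"
  shows "independence_number (cycle_graph n) = n div 2"
proof (rule antisym)
  \<comment> \<open>The largest element is at most \<open>n - 2\<close>, so no wrap-around edge back
    to 0 occurs, even for odd \<open>n\<close>.\<close>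
  define S where "S = (\<lambda>i. 2 * i) ` {..<n div 2}"
  have "independent_vertices (cycle_graph n) S"
    using assms
    by (auto simp: independent_vertices_def pairwise_def S_def cycle_graph_adj_iff; presburger)
  then have "card S \<le> independence_number (cycle_graph n)"
    by (intro independence_number_ge) auto
  then show "n div 2 \<le> independence_number (cycle_graph n)"
    by (simp add: S_def card_image inj_on_def)
next
  have "card S \<le> n div 2" if "independent_vertices (cycle_graph n) S" for S
  proof -
    have S: "S \<subseteq> {..<n}" and indep: "\<And>i j. i \<in> S \<Longrightarrow> j \<in> S \<Longrightarrow> i \<noteq> j \<Longrightarrow> \<not> i \<rightarrow>\<^bsub>cycle_graph n\<^esub> j"
      using that by (auto simp: independent_vertices_def pairwise_def)
    define s where "s = (\<lambda>i. if Suc i = n then 0 else Suc i)"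
    have "inj_on s S" using S by (auto simp: inj_on_def s_def split: if_splits)
    then have cs: "card (s ` S) = card S" by (rule card_image)
    have "s ` S \<subseteq> {..<n}" using S by (auto simp: s_def)
    have "s i \<notin> S" if "i \<in> S" for i
    proof -
      have "i < n" using that S by blast
      then have "i \<rightarrow>\<^bsub>cycle_graph n\<^esub> s i" "i \<noteq> s i"
        using assms by (auto simp: cycle_graph_adj_iff s_def)
      with indep[OF that] show ?thesis by blast
    qed
    then have "S \<inter> s ` S = {}" by blast
    moreover have "finite S" using S finite_subset by blast
    ultimately have "2 * card S = card (S \<union> s ` S)"
      using cs by (simp add: card_Un_disjoint)
    also have "\<dots> \<le> card {..<n}"
      using S \<open>s ` S \<subseteq> {..<n}\<close> by (intro card_mono) auto
    finally show ?thesis by simp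
  qed
  moreover have "independent_vertices (cycle_graph n) {}"
    by (simp add: independent_vertices_def)
  moreover have "finite {card S |S. independent_vertices (cycle_graph n) S}"
    by (rule finite_subset[of _ "card ` Pow {..<n}"]) (auto simp: independent_vertices_def)
  ultimately show "independence_number (cycle_graph n) \<le> n div 2"
    unfolding independence_number_def by (subst Max_le_iff) auto
qed

text \<open>A walk that never turns back in a 2-regular graph first revisits its starting vertex, since
  any other visited vertex already has both its neighbours on the walk.\<close>

lemma two_regular_closed_walk:
  fixes E :: "'a rel"
  assumes fin: "finite V" and ne: "V \<noteq> {}" and sub: "E \<subseteq> V \<times> V" and sym: "sym E"
    and irrefl: "irrefl E" and deg: "\<And>u. u \<in> V \<Longrightarrow> card (E `` {u}) = 2"
  obtains f N where "N \<ge> 3" "inj_on f {..<N}" "f N = f 0" "\<And>i::nat. (f i, f (Suc i)) \<in> E"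
proof -
  have "\<exists>w. (c, w) \<in> E \<and> w \<noteq> p" if "c \<in> V" for p c
  proof (rule ccontr)
    assume "\<not> ?thesis"
    then have "E `` {c} \<subseteq> {p}" by auto
    then have "card (E `` {c}) \<le> card {p}" by (intro card_mono) auto
    with deg[OF that] show False by simp
  qed
  \<comment> \<open>\<open>c \<in> V\<close> moves under the existential so that choice yields a
    total function: \<open>nxt p c\<close> continues a walk that arrived at \<open>c\<close> from
    \<open>p\<close>.\<close>
  then have "\<forall>p c. \<exists>w. c \<in> V \<longrightarrow> (c, w) \<in> E \<and> w \<noteq> p" by blast
  then obtain nxt where nxt: "\<And>p c. c \<in> V \<Longrightarrow> (c, nxt p c) \<in> E \<and> nxt p c \<noteq> p"
    unfolding choice_iff by blast
  obtain a where a: "a \<in> V" using ne by blast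
  \<comment> \<open>The state is the pair of current and next vertex, since choosing a continuation
    needs the vertex just left.\<close>
  define g where "g = rec_nat (a, nxt a a) (\<lambda>_ (p, c). (c, nxt p c))"
  define f where "f = (\<lambda>i. fst (g i))"
  have gE: "(fst (g i), snd (g i)) \<in> E" for i
  proof (induction i)
    case (Suc i)
    then have "snd (g i) \<in> V" using sub by auto
    then show ?case using nxt by (simp add: g_def split_beta)
  qed (use nxt[OF a] in \<open>simp add: g_def\<close>)
  have snd_g: "snd (g i) = f (Suc i)" for i by (simp add: f_def g_def split_beta)
  have fE: "(f i, f (Suc i)) \<in> E" for i using gE[of i] by (simp add: f_def snd_g[unfolded f_def])
  then have fE': "(f (Suc i), f i) \<in> E" for i using sym by (auto dest: symD)
  have fV: "f i \<in> V" for i using fE[of i] sub by blast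
  have turn: "f (Suc (Suc i)) \<noteq> f i" for i
  proof -
    have "f (Suc (Suc i)) = nxt (f i) (f (Suc i))"
      unfolding snd_g[of "Suc i", symmetric] by (simp add: g_def split_beta f_def)
    then show ?thesis using nxt[OF fV] by simp
  qed
  have step: "f (Suc i) \<noteq> f i" for i using fE[of i] irrefl by (auto simp: irrefl_def)
  define P where "P = (\<lambda>k. f k \<in> f ` {..<k})"
  have "\<exists>k. P k"
  proof (rule ccontr)
    assume no: "\<not> ?thesis"
    have "inj f"
    proof (rule linorder_injI)
      fix i j :: nat assume "i < j"
      then show "f i \<noteq> f j" using no unfolding P_def by (metis imageI lessThan_iff)
    qed
    moreover have "finite (range f)" by (rule finite_subset[OF _ fin]) (use fV in auto)
    ultimately show False using finite_imageD by auto
  qed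
  \<comment> \<open>The first time a vertex repeats; minimality makes \<open>f\<close> injective
    before \<open>N\<close>.\<close>
  define N where "N = (LEAST k. P k)"
  have "P N" unfolding N_def using \<open>\<exists>k. P k\<close> by (auto intro: LeastI)
  then obtain j where j: "j < N" "f N = f j" unfolding P_def by auto
  have inj: "inj_on f {..<N}"
  proof (rule linorder_inj_onI)
    fix i k assume "i < k" "k \<in> {..<N}"
    then have "\<not> P k" unfolding N_def using not_less_Least by blast
    with \<open>i < k\<close> show "f i \<noteq> f k" unfolding P_def by (metis imageI lessThan_iff)
  qed auto
  obtain M where M: "N = Suc M" using j(1) by (cases N) auto
  have "j = 0"
  proof (rule ccontr)
    assume "j \<noteq> 0"
    then obtain i where i: "j = Suc i" using not0_implies_Suc by blast
    \<comment> \<open>Predecessor and successor of \<open>f j\<close> on the walk differ by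
      \<open>turn\<close>, so they are all its neighbours. The last vertex \<open>f M\<close> before
      the return is also a neighbour, but equating it with either contradicts injectivity,
      \<open>turn\<close> or \<open>step\<close>.\<close>
    have "{f i, f (Suc j)} = E `` {f j}"
    proof (rule card_subset_eq)
      show "finite (E `` {f j})" using deg[OF fV] card.infinite by force
      show "{f i, f (Suc j)} \<subseteq> E `` {f j}" using fE fE' i by auto
      show "card {f i, f (Suc j)} = card (E `` {f j})"
        using deg[OF fV] turn[of i] i by auto
    qed
    moreover have "f M \<in> E `` {f j}" using fE'[of M] j M by simp
    ultimately have "f M = f i \<or> f M = f (Suc j)" by blast
    then show False
    proof
      assume "f M = f i"
      then have "M = i" using inj_onD[OF inj] i j M by auto
      then show False using i j M by simp
    next
      assume eq: "f M = f (Suc j)"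
      show False
      proof (cases "Suc j < N")
        case True
        then have "M = Suc j" using inj_onD[OF inj eq] M by auto
        then show False using turn[of j] j M by simp
      next
        case False
        then have "M = j" using j M by simp
        then show False using eq step[of j] by simp
      qed
    qed
  qed
  \<comment> \<open>A return after one step would be a loop, after two steps a reversal.\<close>
  have "N \<noteq> 1" using step[of 0] j \<open>j = 0\<close> by auto
  moreover have "N \<noteq> 2" using turn[of 0] j \<open>j = 0\<close> by (auto simp: numeral_2_eq_2)
  ultimately have "N \<ge> 3" using j by linarith
  then show thesis using that inj j(2) \<open>j = 0\<close> fE by blast
qed

text \<open>Each vertex of the closed walk has both its neighbours on the walk, so no edge leaves it
  and connectedness makes it exhaust \<open>V\<close>.\<close>

lemma two_regular_imp_cycle:
  fixes E :: "'a rel"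
  assumes fin: "finite V" and ne: "V \<noteq> {}" and sub: "E \<subseteq> V \<times> V" and sym: "sym E"
    and irrefl: "irrefl E" and deg: "\<And>u. u \<in> V \<Longrightarrow> card (E `` {u}) = 2"
    and conn: "\<And>u v. u \<in> V \<Longrightarrow> v \<in> V \<Longrightarrow> (u, v) \<in> E\<^sup>*"
  obtains f where "bij_betw f {..<card V} V"
    "\<And>i j. i < card V \<Longrightarrow> j < card V \<Longrightarrow> (f i, f j) \<in> E \<longleftrightarrow> i \<rightarrow>\<^bsub>cycle_graph (card V)\<^esub> j"
proof -
  obtain f N where N: "N \<ge> 3" and inj: "inj_on f {..<N}" and f0: "f N = f 0"
    and fE: "\<And>i. (f i, f (Suc i)) \<in> E"
    using two_regular_closed_walk[OF assms(1-6)] by blast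
  let ?C = "arcs_ends (cycle_graph N)"
  have fV: "f i \<in> V" for i using fE[of i] sub by blast
  have fE': "(f (Suc i), f i) \<in> E" for i using fE sym by (auto dest: symD)
  \<comment> \<open>\<open>f\<close> maps the two cycle neighbours of \<open>i\<close> injectively
    into the two neighbours of \<open>f i\<close>, so counting gives equality. This also excludes
    chords.\<close>
  have nbrs: "f ` (?C `` {i}) = E `` {f i}" if "i < N" for i
  proof (rule card_subset_eq)
    show "finite (E `` {f i})" using deg[OF fV] card.infinite by force
    show "f ` (?C `` {i}) \<subseteq> E `` {f i}"
    proof clarsimp
      fix j assume "i \<rightarrow>\<^bsub>cycle_graph N\<^esub> j"
      then show "(f i, f j) \<in> E"
        using fE[of i] fE'[of j] f0 unfolding cycle_graph_adj_iff by auto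
    qed
    have "inj_on f (?C `` {i})"
      by (rule inj_on_subset[OF inj]) (auto simp: cycle_graph_adj_iff)
    then show "card (f ` (?C `` {i})) = card (E `` {f i})"
      using deg[OF fV] card_neighbours_cycle_graph[OF N that] by (simp add: card_image)
  qed
  have "V \<subseteq> f ` {..<N}"
  proof
    fix v assume "v \<in> V"
    from conn[OF fV[of 0] this] show "v \<in> f ` {..<N}"
    proof (induction rule: rtrancl_induct)
      case base
      then show ?case using N by auto
    next
      case (step y z)
      then obtain i where i: "i < N" "y = f i" by auto
      with step nbrs[OF i(1)] have "z \<in> f ` (?C `` {i})" by auto
      then show ?case by (auto simp: cycle_graph_adj_iff)
    qed
  qed
  then have bij: "bij_betw f {..<N} V" using inj fV by (auto simp: bij_betw_def)
  then have card: "card V = N" using bij_betw_same_card by fastforce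
  have "(f i, f j) \<in> E \<longleftrightarrow> i \<rightarrow>\<^bsub>cycle_graph N\<^esub> j" if ij: "i < N" "j < N" for i j
  proof -
    have "(f i, f j) \<in> E \<longleftrightarrow> f j \<in> f ` (?C `` {i})" using nbrs[OF ij(1)] by auto
    also have "\<dots> \<longleftrightarrow> j \<in> ?C `` {i}"
      by (rule inj_on_image_mem_iff[OF inj]) (use ij in \<open>auto simp: cycle_graph_adj_iff\<close>)
    finally show ?thesis by simp
  qed
  then show thesis using that[of f] bij card by simp
qed

section \<open>Isomorphisms\<close>

text \<open>Without parallel arcs an arc is determined by its ends, so an adjacency-preserving
  vertex bijection induces the arc map; arcs of \<open>with_proj H\<close> are themselves pairs of
  vertices.\<close>

lemma digraph_iso_with_projI:
  assumes "nomulti_digraph G" and bij: "bij_betw h (verts G) (pverts H)"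
    and adj: "\<And>u v. u \<in> verts G \<Longrightarrow> v \<in> verts G \<Longrightarrow> u \<rightarrow>\<^bsub>G\<^esub> v \<longleftrightarrow> (h u, h v) \<in> parcs H"
    and wf: "parcs H \<subseteq> pverts H \<times> pverts H"
  shows "digraph_iso G (with_proj H)"
proof -
  interpret nomulti_digraph G by fact
  define iso where "iso = \<lparr>iso_verts = h, iso_arcs = (\<lambda>e. (h (tail G e), h (head G e))),
    iso_head = snd, iso_tail = fst\<rparr>"
  have inj: "inj_on h (verts G)" and img: "h ` verts G = pverts H"
    using bij by (auto simp: bij_betw_def)
  have "inj_on (iso_arcs iso) (arcs G)"
  proof (rule inj_onI)
    fix e e' assume e: "e \<in> arcs G" "e' \<in> arcs G" "iso_arcs iso e = iso_arcs iso e'"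
    then have "arc_to_ends G e = arc_to_ends G e'"
      using inj by (auto simp: iso_def arc_to_ends_def dest: inj_onD)
    with e show "e = e'" using no_multi_arcs by blast
  qed
  then have "digraph_isomorphism iso"
    using inj wf_digraph by (simp add: digraph_isomorphism_def iso_def)
  moreover have "iso_arcs iso ` arcs G = parcs H"
  proof -
    have "iso_arcs iso ` arcs G = map_prod h h ` arcs_ends G"
      by (auto simp: iso_def arcs_ends_conv image_image)
    also have "\<dots> = parcs H"
    proof
      show "map_prod h h ` arcs_ends G \<subseteq> parcs H" using adj by (auto dest: adj_in_verts)
      show "parcs H \<subseteq> map_prod h h ` arcs_ends G"
      proof clarify
        fix x y assume xy: "(x, y) \<in> parcs H"
        with wf img obtain u v where "x = h u" "y = h v" "u \<in> verts G" "v \<in> verts G" by blast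
        with xy adj show "(x, y) \<in> map_prod h h ` arcs_ends G" by force
      qed
    qed
    finally show ?thesis .
  qed
  then have "with_proj H = app_iso iso G"
    using img by (simp add: app_iso_def with_proj_def iso_def)
  ultimately show ?thesis unfolding digraph_iso_def by blast
qed

text \<open>Carrying an enumeration of the vertices along the isomorphism leaves the adjacency
  matrix literally unchanged.\<close>

lemma graph_spectral_radius_digraph_iso:
  assumes "digraph_iso G H" "finite (verts G)"
  shows "graph_spectral_radius G = graph_spectral_radius H"
proof -
  obtain iso where iso: "pre_digraph.digraph_isomorphism G iso" "H = app_iso iso G"
    using assms(1) unfolding digraph_iso_def by blast
  define h where "h = iso_verts iso"
  interpret wf_digraph G using iso(1) by (simp add: pre_digraph.digraph_isomorphism_def)
  have inj: "inj_on h (verts G)"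
    and ends: "\<And>e. e \<in> arcs G \<Longrightarrow> tail H (iso_arcs iso e) = h (tail G e)"
      "\<And>e. e \<in> arcs G \<Longrightarrow> head H (iso_arcs iso e) = h (head G e)"
    using iso by (auto simp: digraph_isomorphism_def h_def)
  have arcs: "arcs H = iso_arcs iso ` arcs G" and verts: "verts H = h ` verts G"
    using iso(2) by (auto simp: h_def)
  have "arcs_ends H = map_prod h h ` arcs_ends G"
    unfolding arcs_ends_conv arcs image_image using ends by auto
  then have adj: "h u \<rightarrow>\<^bsub>H\<^esub> h v \<longleftrightarrow> u \<rightarrow>\<^bsub>G\<^esub> v" if "u \<in> verts G" "v \<in> verts G" for u v
    using that inj_onD[OF inj] adj_in_verts by (auto; metis)
  obtain vs where vs: "distinct vs" "set vs = verts G"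
    using finite_distinct_list[OF assms(2)] by blast
  have "distinct (map h vs)" "set (map h vs) = verts H"
    using vs inj verts by (auto simp: distinct_map)
  moreover have "adjacency_matrix H (map h vs) = adjacency_matrix G vs"
    unfolding adjacency_matrix_def
    by (rule cong_mat) (simp_all add: adj vs(2)[symmetric])
  ultimately show ?thesis
    using graph_spectral_radius_eq[OF vs] graph_spectral_radius_eq by metis
qed

lemma (in graph) two_regular_imp_iso_cycle_graph:
  assumes conn: "Digraph_Component.connected G"
    and deg: "\<And>u. u \<in> verts G \<Longrightarrow> card (arcs_ends G `` {u}) = 2"
  shows "digraph_iso G (cycle_graph (card (verts G)))"
proof -
  let ?n = "card (verts G)"
  have E: "arcs_ends G \<subseteq> verts G \<times> verts G" "sym (arcs_ends G)" "irrefl (arcs_ends G)"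
    using sym_arcs adj_not_same by (auto simp: symmetric_def irrefl_def dest: adj_in_verts)
  have "verts G \<noteq> {}" "\<And>u v. u \<in> verts G \<Longrightarrow> v \<in> verts G \<Longrightarrow> (u, v) \<in> (arcs_ends G)\<^sup>*"
    using conn unfolding connected_iff_rtrancl by auto
  then obtain f where bij: "bij_betw f {..<?n} (verts G)"
    and adj: "\<And>i j. i < ?n \<Longrightarrow> j < ?n \<Longrightarrow> f i \<rightarrow>\<^bsub>G\<^esub> f j \<longleftrightarrow> i \<rightarrow>\<^bsub>cycle_graph ?n\<^esub> j"
    using two_regular_imp_cycle[OF finite_verts _ E deg] by blast
  \<comment> \<open>The isomorphism has to start at \<open>G\<close>, so the numbering
    \<open>f\<close> is inverted.\<close>
  define h where "h = the_inv_into {..<?n} f"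
  have h: "bij_betw h (verts G) {..<?n}"
    unfolding h_def using bij by (rule bij_betw_the_inv_into)
  have fh: "f (h u) = u" "h u < ?n" if "u \<in> verts G" for u
    using that bij h by (auto simp: h_def bij_betw_def f_the_inv_into_f)
  have "u \<rightarrow>\<^bsub>G\<^esub> v \<longleftrightarrow> h u \<rightarrow>\<^bsub>cycle_graph ?n\<^esub> h v" if "u \<in> verts G" "v \<in> verts G" for u v
    using adj[of "h u" "h v"] fh that by simp
  then show ?thesis
    unfolding cycle_graph_def
    by (intro digraph_iso_with_projI nomulti_digraph) (use h in auto)
qed

section \<open>Minimality and uniqueness of the odd cycle\<close>

theorem theorem4p2:
  fixes n :: nat
  assumes "n \<ge> 3" and "odd n"
  shows "admissible_graph n (cycle_graph n) \<and>
    (\<forall>G :: ('a, 'b) pre_digraph. admissible_graph n G \<longrightarrow>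
       graph_spectral_radius (cycle_graph n) \<le> graph_spectral_radius G \<and>
       (graph_spectral_radius G = graph_spectral_radius (cycle_graph n)
          \<longleftrightarrow> digraph_iso G (cycle_graph n)))"
proof (intro conjI allI impI)
  have half: "\<lceil>real n / 2\<rceil> - 1 = int (n div 2)"
  proof -
    obtain m where "n = 2 * m + 1" using assms(2) by (rule oddE)
    moreover have "\<lceil>real (2 * m + 1) / 2\<rceil> = int m + 1"
      by (rule ceiling_unique) auto
    ultimately show ?thesis by simp
  qed
  \<comment> \<open>The cycle lives on \<open>nat\<close>, whereas \<open>G\<close> ranges over
    graphs on an arbitrary type, so its admissibility is a separate claim.\<close>
  show "admissible_graph n (cycle_graph n)"
    using assms graph_cycle_graph connected_cycle_graph independence_number_cycle_graph half
    by (simp add: admissible_graph_def)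
  interpret C: graph "cycle_graph n" using assms(1) by (rule graph_cycle_graph)
  have \<rho>C: "graph_spectral_radius (cycle_graph n) = 2"
    using C.spectral_radius_regular[of 2] card_neighbours_cycle_graph assms(1)
    by (simp add: lessThan_empty_iff)
  fix G :: "('a, 'b) pre_digraph" assume "admissible_graph n G"
  then have "graph G" and conn: "Digraph_Component.connected G" and card: "card (verts G) = n"
    and alpha: "independence_number G = n div 2"
    using half by (auto simp: admissible_graph_def)
  interpret graph G by fact
  have ne: "verts G \<noteq> {}" using card assms(1) by auto
  \<comment> \<open>Oddness enters here: \<open>2 * (n div 2) = n - 1\<close>.\<close>
  have "2 * independence_number G < card (verts G)"
    unfolding alpha card using assms(2) by presburger
  from card_arcs_ends_ge_of_independence_number[OF conn this]
  have "2 * real n \<le> real (card (arcs_ends G))" unfolding card by simp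
  note arcs = this card_arcs_ends_le_spectral_radius(1)[OF ne, unfolded card]
  then have "2 * real n \<le> graph_spectral_radius G * real n" by linarith
  then have ge: "2 \<le> graph_spectral_radius G" using assms(1) by simp
  then show "graph_spectral_radius (cycle_graph n) \<le> graph_spectral_radius G"
    unfolding \<rho>C .
  show "graph_spectral_radius G = graph_spectral_radius (cycle_graph n)
    \<longleftrightarrow> digraph_iso G (cycle_graph n)"
  proof
    assume eq: "graph_spectral_radius G = graph_spectral_radius (cycle_graph n)"
    \<comment> \<open>With spectral radius 2 the lower and upper bounds on the number of arcs meet
      at \<open>2 * n\<close>, which is the equality case of the average-degree bound.\<close>
    with arcs \<rho>C have "real (card (arcs_ends G)) = graph_spectral_radius G * real (card (verts G))"
      unfolding card by simp
    from card_arcs_ends_le_spectral_radius(2)[OF ne this]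
    have "card (arcs_ends G `` {u}) = 2" if "u \<in> verts G" for u
      using that eq \<rho>C by simp
    from two_regular_imp_iso_cycle_graph[OF conn this]
    show "digraph_iso G (cycle_graph n)" unfolding card .
  qed (rule graph_spectral_radius_digraph_iso[OF _ finite_verts])
qed

end
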